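(* Let $G=(V,E)$ be a complete graph with metric cost $c:E\to\mathbb{R}_+$ and distinct endpoints $s,t\in V$. Let $x^*$ be an optimal solution to the path-variant Held-Karp relaxation, written as a convex combination $x^*=\sum_{i=1}^k\lambda_i\chi_{\mathscr{T}_i}$ of incidence vectors of spanning trees. Let $\mathscr{T}$ be sampled as $\mathscr{T}_i$ with probability $\lambda_i$; let $T$ be the set of vertices in $V\setminus\{s,t\}$ of odd degree in $\mathscr{T}$ together with those of $s,t$ of even degree in $\mathscr{T}$; let $J$ be a minimum-cost $T$-join; and let $H$ be the Hamiltonian $s$-$t$ path obtained by shortcutting an Eulerian $s$-$t$ path of the multigraph $\mathscr{T}\cup J$. Then $\mathbb{E}[c(H)]\le1.6577\,c(x^* )$.
   Context: For $F\subseteq E$, $\chi_F$ is its incidence vector; $x(F)=\sum_{e\in F}x_e$; $c(x)=\sum_ec_ex_e$; $\delta(S)$ is the set of edges with exactly one endpoint in $S$. The path-variant Held-Karp relaxation: minimize $c(x)$ subject to $x(\delta(S))\ge1$ for all $S\subsetneq V$ with $|S\cap\{s,t\}|=1$; $x(\delta(S))\ge2$ for all nonempty $S\subsetneq V$ with $|S\cap\{s,t\}|\ne1$; $x(\delta(\{s\}))=x(\delta(\{t\}))=1$; $x(\delta(\{v\}))=2$ for $v\in V\setminus\{s,t\}$; $x\ge0$. A $T$-join is an edge set whose set of odd-degree vertices is exactly $T$. *)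

theory Defs
  imports "HOL-Probability.Probability" "HOL-Library.Multiset" "HOL-Library.Sublist"
begin

text \<open>Undirected edges are two-element vertex sets. Edge vectors are functions on
  \<^typ>\<open>'a set\<close> of which only the values on the edge set matter.\<close>

definition complete_edges :: "'a set \<Rightarrow> 'a set set" where
  "complete_edges V = {e. e \<subseteq> V \<and> card e = 2}"

text \<open>The triangle inequality is only required for distinct vertices, since
  \<^term>\<open>{u, u}\<close> is not an edge.\<close>

definition metric_cost :: "'a set \<Rightarrow> ('a set \<Rightarrow> real) \<Rightarrow> bool" where
  "metric_cost V c \<longleftrightarrow>
     (\<forall>e\<in>complete_edges V. c e \<ge> 0) \<and>
     (\<forall>u\<in>V. \<forall>v\<in>V. \<forall>w\<in>V. u \<noteq> v \<longrightarrow> v \<noteq> w \<longrightarrow> u \<noteq> w \<longrightarrow>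
        c {u, w} \<le> c {u, v} + c {v, w})"

definition cost_vec :: "'a set \<Rightarrow> ('a set \<Rightarrow> real) \<Rightarrow> ('a set \<Rightarrow> real) \<Rightarrow> real" where
  "cost_vec V c x = (\<Sum>e\<in>complete_edges V. c e * x e)"

definition cut :: "'a set \<Rightarrow> 'a set \<Rightarrow> 'a set set" where
  "cut V S = {e \<in> complete_edges V. card (e \<inter> S) = 1}"

definition held_karp_feasible ::
  "'a set \<Rightarrow> 'a \<Rightarrow> 'a \<Rightarrow> ('a set \<Rightarrow> real) \<Rightarrow> bool" where
  "held_karp_feasible V s t x \<longleftrightarrow>
     (\<forall>S. S \<subset> V \<longrightarrow> card (S \<inter> {s, t}) = 1 \<longrightarrow> sum x (cut V S) \<ge> 1) \<and>
     (\<forall>S. S \<subset> V \<longrightarrow> S \<noteq> {} \<longrightarrow> card (S \<inter> {s, t}) \<noteq> 1 \<longrightarrow> sum x (cut V S) \<ge> 2) \<and>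
     sum x (cut V {s}) = 1 \<and> sum x (cut V {t}) = 1 \<and>
     (\<forall>v\<in>V - {s, t}. sum x (cut V {v}) = 2) \<and>
     (\<forall>e\<in>complete_edges V. x e \<ge> 0)"

definition held_karp_optimal ::
  "'a set \<Rightarrow> ('a set \<Rightarrow> real) \<Rightarrow> 'a \<Rightarrow> 'a \<Rightarrow> ('a set \<Rightarrow> real) \<Rightarrow> bool" where
  "held_karp_optimal V c s t x \<longleftrightarrow>
     held_karp_feasible V s t x \<and>
     (\<forall>y. held_karp_feasible V s t y \<longrightarrow> cost_vec V c x \<le> cost_vec V c y)"

definition walk_edges :: "'a list \<Rightarrow> 'a set list" where
  "walk_edges vs = map2 (\<lambda>u v. {u, v}) vs (tl vs)"

definition walk_cost :: "('a set \<Rightarrow> real) \<Rightarrow> 'a list \<Rightarrow> real" where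
  "walk_cost c vs = sum_list (map c (walk_edges vs))"

definition joins :: "'a list \<Rightarrow> 'a \<Rightarrow> 'a \<Rightarrow> bool" where
  "joins vs u v \<longleftrightarrow> vs \<noteq> [] \<and> hd vs = u \<and> last vs = v"

definition connected_on :: "'a set \<Rightarrow> 'a set set \<Rightarrow> bool" where
  "connected_on V F \<longleftrightarrow> (\<forall>u\<in>V. \<forall>v\<in>V. \<exists>vs. joins vs u v \<and> set (walk_edges vs) \<subseteq> F)"

definition acyclic_edges :: "'a set set \<Rightarrow> bool" where
  "acyclic_edges F \<longleftrightarrow>
     \<not> (\<exists>vs. length vs \<ge> 3 \<and> distinct vs \<and> set (walk_edges (vs @ [hd vs])) \<subseteq> F)"

definition is_spanning_tree :: "'a set \<Rightarrow> 'a set set \<Rightarrow> bool" where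
  "is_spanning_tree V F \<longleftrightarrow> F \<subseteq> complete_edges V \<and> connected_on V F \<and> acyclic_edges F"

definition edge_degree :: "'a set set \<Rightarrow> 'a \<Rightarrow> nat" where
  "edge_degree F v = card {e \<in> F. v \<in> e}"

definition T_join :: "'a set \<Rightarrow> 'a set \<Rightarrow> 'a set set \<Rightarrow> bool" where
  "T_join V T J \<longleftrightarrow> J \<subseteq> complete_edges V \<and> {v \<in> V. odd (edge_degree J v)} = T"

definition min_cost_T_join ::
  "'a set \<Rightarrow> ('a set \<Rightarrow> real) \<Rightarrow> 'a set \<Rightarrow> 'a set set \<Rightarrow> bool" where
  "min_cost_T_join V c T J \<longleftrightarrow> T_join V T J \<and> (\<forall>K. T_join V T K \<longrightarrow> sum c J \<le> sum c K)"

definition wrong_parity :: "'a set \<Rightarrow> 'a \<Rightarrow> 'a \<Rightarrow> 'a set set \<Rightarrow> 'a set" where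
  "wrong_parity V s t F =
     {v \<in> V - {s, t}. odd (edge_degree F v)} \<union> {v \<in> {s, t}. even (edge_degree F v)}"

text \<open>A multigraph is given by its multiset of edges, so an edge lying in both the tree
  and the join is traversed twice.\<close>

definition eulerian_path :: "'a set multiset \<Rightarrow> 'a \<Rightarrow> 'a \<Rightarrow> 'a list \<Rightarrow> bool" where
  "eulerian_path M s t W \<longleftrightarrow> joins W s t \<and> mset (walk_edges W) = M"

definition hamiltonian_path :: "'a set \<Rightarrow> 'a \<Rightarrow> 'a \<Rightarrow> 'a list \<Rightarrow> bool" where
  "hamiltonian_path V s t H \<longleftrightarrow> joins H s t \<and> distinct H \<and> set H = V"

text \<open>Shortcutting a walk deletes repeated visits. Which visit of a vertex is kept is left open,
  as keeping the first one need not end in \<^term>\<open>t\<close>.\<close>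

definition shortcut_path :: "'a set \<Rightarrow> 'a \<Rightarrow> 'a \<Rightarrow> 'a list \<Rightarrow> 'a list \<Rightarrow> bool" where
  "shortcut_path V s t W H \<longleftrightarrow> hamiltonian_path V s t H \<and> subseq H W"

end

theory Submission
  imports Defs
begin

text \<open>Shortcutting costs nothing in a metric, so it suffices to bound the expected cost of the join.
  By the theorem of Edmonds and Johnson a minimum-cost T-join costs at most \<open>c(y)\<close> for every
  \<open>y \<ge> 0\<close> of weight at least 1 on all T-odd cuts. Take \<open>y\<close> to be a combination of the tree
  and \<open>x\<close>. Its only violated constraints belong to \<open>s\<close>-\<open>t\<close> cuts of \<open>x\<close>-weight less than
  \<open>1 + \<tau>\<close> that the tree crosses an even number of times. Each such cut is even with probability
  less than \<open>\<tau>\<close>, since the tree crosses it at least once and at most \<open>1 + \<tau>\<close> times in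
  expectation. These cuts form a chain, whose layers give disjoint edge sets of \<open>x\<close>-weight at
  least \<open>1 - \<tau> / 2\<close>; they pay for repairing the violated constraints.\<close>

section \<open>Parity of edge sets\<close>

lemma complete_edgesE:
  assumes "e \<in> complete_edges V"
  obtains u v where "e = {u, v}" "u \<noteq> v" "u \<in> V" "v \<in> V"
  using assms by (auto simp: complete_edges_def card_2_iff)

lemma finite_complete_edges [simp]: "finite V \<Longrightarrow> finite (complete_edges V)"
  by (rule finite_subset[of _ "Pow V"]) (auto simp: complete_edges_def)

lemma doubleton_in_complete_edges [simp]:
  "{u, v} \<in> complete_edges V \<longleftrightarrow> u \<noteq> v \<and> u \<in> V \<and> v \<in> V"
  by (auto simp: complete_edges_def card_2_iff doubleton_eq_iff)

lemma cut_subset: "cut V S \<subseteq> complete_edges V"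
  by (auto simp: cut_def)

lemma finite_cut [simp]: "finite V \<Longrightarrow> finite (cut V S)"
  by (rule finite_subset[OF cut_subset]) simp

lemma doubleton_in_cut:
  "{u, v} \<in> cut V S \<longleftrightarrow> u \<noteq> v \<and> u \<in> V \<and> v \<in> V \<and> (u \<in> S \<longleftrightarrow> v \<notin> S)"
  by (cases "u \<in> S"; cases "v \<in> S") (auto simp: cut_def Int_insert_left)

lemma cutE:
  assumes "e \<in> cut V S"
  obtains u v where "e = {u, v}" "u \<in> V" "v \<in> V" "u \<in> S" "v \<notin> S"
proof -
  from assms obtain u v where "e = {u, v}" "u \<noteq> v" "u \<in> V" "v \<in> V"
    using complete_edgesE cut_subset by (metis subsetD)
  with assms that[of u v] that[of v u] show ?thesis
    by (auto simp: doubleton_in_cut)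
qed

lemma cut_Compl: "cut V (V - S) = cut V S"
proof -
  have "e \<in> cut V (V - S) \<longleftrightarrow> e \<in> cut V S" if "e \<in> complete_edges V" for e
    using that by (elim complete_edgesE) (auto simp: doubleton_in_cut)
  with cut_subset show ?thesis by blast
qed

text \<open>Common elements are counted twice, so they vanish modulo 2. Edge sets are therefore
  treated as vectors over the two-element field, with \<open>sym_diff\<close> as addition.\<close>

lemma even_card_sym_diff:
  assumes "finite A" "finite B"
  shows "even (card (sym_diff A B)) \<longleftrightarrow> (even (card A) \<longleftrightarrow> even (card B))"
proof -
  have "card (sym_diff A B) = card (A - B) + card (B - A)"
    using assms by (intro card_Un_disjoint) auto
  moreover have "card A = card (A - B) + card (A \<inter> B)" "card B = card (B - A) + card (A \<inter> B)"
    using assms by (subst card_Un_disjoint[symmetric]; auto intro: arg_cong[where f = card])+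
  ultimately show ?thesis by auto
qed

lemma odd_edge_degree_sym_diff:
  assumes "finite A" "finite B"
  shows "odd (edge_degree (sym_diff A B) v) \<longleftrightarrow> odd (edge_degree A v) \<noteq> odd (edge_degree B v)"
proof -
  have "{e \<in> sym_diff A B. v \<in> e} = sym_diff {e \<in> A. v \<in> e} {e \<in> B. v \<in> e}" by auto
  then show ?thesis
    using assms by (simp add: edge_degree_def even_card_sym_diff)
qed

lemma T_join_finite: "finite V \<Longrightarrow> T_join V T J \<Longrightarrow> finite J"
  by (auto simp: T_join_def intro: finite_subset)

text \<open>Degree parities add modulo 2. The target \<open>U\<close> enters through an equation so
  that each use can state it in simplified form.\<close>

lemma T_join_sym_diff:
  assumes "finite V" "T_join V S A" "T_join V T B" "U = sym_diff S T"
  shows "T_join V U (sym_diff A B)"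
proof -
  have "finite A" "finite B" using assms T_join_finite by auto
  then show ?thesis
    using assms(2-4) by (auto simp: T_join_def odd_edge_degree_sym_diff)
qed

lemma T_join_edge:
  assumes "{u, v} \<in> complete_edges V"
  shows "T_join V (sym_diff {u} {v}) {{u, v}}"
proof -
  have "{e \<in> {{u, v}}. w \<in> e} = (if w \<in> {u, v} then {{u, v}} else {})" for w by auto
  then have "edge_degree {{u, v}} w = (if w \<in> {u, v} then 1 else 0)" for w
    by (simp add: edge_degree_def)
  then show ?thesis using assms by (auto simp: T_join_def)
qed

text \<open>The edges of a walk are added modulo 2, so repetitions cancel and the walk need not be
  simple. Writing the endpoints as \<open>sym_diff {u} {v}\<close> also covers closed walks, where
  this set is empty.\<close>

lemma T_join_reachable:
  assumes "finite V" "F \<subseteq> complete_edges V" "(u, v) \<in> {(a, b). {a, b} \<in> F}\<^sup>*"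
  shows "\<exists>P \<subseteq> F. T_join V (sym_diff {u} {v}) P"
  using assms(3)
proof (induction rule: rtrancl_induct)
  case base
  show ?case by (rule exI[of _ "{}"]) (simp add: T_join_def edge_degree_def)
next
  case (step v w)
  then obtain P where P: "P \<subseteq> F" "T_join V (sym_diff {u} {v}) P" by blast
  have vw: "{v, w} \<in> F" using step by simp
  with assms(2) have "{v, w} \<in> complete_edges V" by (rule subsetD)
  note vw = vw this
  have "T_join V (sym_diff {u} {w}) (sym_diff P {{v, w}})"
    using vw by (intro T_join_sym_diff[OF assms(1) P(2) T_join_edge]) auto
  with P vw show ?case by (intro exI[of _ "sym_diff P {{v, w}}"]) auto
qed

text \<open>Handshake argument on \<open>S\<close>: in the sum of degrees an edge inside
  \<open>S\<close> counts twice and an edge of the cut once.\<close>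

lemma odd_card_odd_degrees:
  assumes "finite V" "F \<subseteq> complete_edges V" "S \<subseteq> V"
  shows "odd (card {v \<in> S. odd (edge_degree F v)}) \<longleftrightarrow> odd (card (F \<inter> cut V S))"
proof -
  have fin: "finite F" "finite S"
    using assms finite_subset[OF assms(2)] finite_subset[OF assms(3)] by auto
  have "(\<Sum>v\<in>S. edge_degree F v) = (\<Sum>v\<in>S. \<Sum>e\<in>F. of_bool (v \<in> e))"
    using fin by (simp add: edge_degree_def Int_def)
  also have "\<dots> = (\<Sum>e\<in>F. \<Sum>v\<in>S. of_bool (v \<in> e))" by (rule sum.swap)
  also have "\<dots> = (\<Sum>e\<in>F. card (e \<inter> S))"
    using fin by (simp add: Int_def conj_commute)
  finally have "even (\<Sum>v\<in>S. edge_degree F v) \<longleftrightarrow> even (\<Sum>e\<in>F. card (e \<inter> S))"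
    by simp
  then have "even (card {v \<in> S. odd (edge_degree F v)})
      \<longleftrightarrow> even (card {e \<in> F. odd (card (e \<inter> S))})"
    using fin by (simp add: even_sum_iff)
  moreover have "odd (card (e \<inter> S)) \<longleftrightarrow> e \<in> cut V S" if "e \<in> F" for e
  proof -
    have "e \<in> complete_edges V" using that assms by auto
    then show ?thesis
      by (elim complete_edgesE) (auto simp: cut_def Int_insert_left)
  qed
  then have "{e \<in> F. odd (card (e \<inter> S))} = F \<inter> cut V S" by auto
  ultimately show ?thesis by simp
qed

lemma T_join_odd_cut:
  assumes "finite V" "T_join V T J" "S \<subseteq> V"
  shows "odd (card (S \<inter> T)) \<longleftrightarrow> odd (card (J \<inter> cut V S))"
proof -
  have "S \<inter> T = {v \<in> S. odd (edge_degree J v)}" using assms by (auto simp: T_join_def)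
  then show ?thesis using odd_card_odd_degrees[of V J S] assms by (simp add: T_join_def)
qed

lemma sum_sym_diff:
  fixes c :: "'b \<Rightarrow> real"
  assumes "finite A" "finite B"
  shows "sum c (sym_diff A B) = sum c A + sum c B - 2 * sum c (A \<inter> B)"
proof -
  have "sum c (sym_diff A B) = sum c (A - B) + sum c (B - A)"
    using assms by (intro sum.union_disjoint) auto
  moreover have "sum c (A - B) = sum c A - sum c (A \<inter> B)" "sum c (B - A) = sum c B - sum c (A \<inter> B)"
    using sum.Int_Diff[OF assms(1), of c B] sum.Int_Diff[OF assms(2), of c A]
    by (simp_all add: Int_commute)
  ultimately show ?thesis by simp
qed

section \<open>The T-join polyhedron\<close>

lemma sum_sym_diff_zero:
  fixes c :: "'b \<Rightarrow> real"
  assumes "finite A" "finite Q" "\<And>e. e \<in> Q \<Longrightarrow> c e = 0"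
  shows "sum c (sym_diff A Q) = sum c A"
  using assms by (simp add: sum_sym_diff sum.neutral)

text \<open>The odd set is \<open>b\<close>'s component in the graph of zero-cost edges, where \<open>b\<close> is chosen
  so that correcting the parity of \<open>T\<close> at \<open>b\<close> and at an endpoint \<open>x0\<close> of a positive edge of
  an optimal join is cheapest. A join \<open>K\<close> attaining this minimum cannot leave the component, so
  three edges of an optimal join \<open>J\<close> leaving it would leave a cycle in \<open>J\<close> and \<open>K\<close>, along which
  both could be exchanged.\<close>

lemma exists_tight_odd_cut:
  fixes c :: "'a set \<Rightarrow> real"
  assumes fin: "finite V"
    and c: "\<And>e. e \<in> complete_edges V \<Longrightarrow> c e \<ge> 0"
    and J0: "min_cost_T_join V c T J0" "sum c J0 > 0"
  obtains B where "B \<subseteq> V" "odd (card (B \<inter> T))" "\<And>e. e \<in> cut V B \<Longrightarrow> c e > 0"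
    "\<And>J. min_cost_T_join V c T J \<Longrightarrow> card (J \<inter> cut V B) = 1"
proof -
  have T0: "T_join V T J0" and min0: "\<And>K. T_join V T K \<Longrightarrow> sum c J0 \<le> sum c K"
    using J0(1) by (auto simp: min_cost_T_join_def)
  have J0E: "J0 \<subseteq> complete_edges V" and TV: "T \<subseteq> V" using T0 by (auto simp: T_join_def)
  obtain e0 where e0: "e0 \<in> J0" "c e0 > 0"
    using J0(2) by (meson linorder_not_less sum_nonpos)
  then obtain x0 v0 where x0: "e0 = {x0, v0}" "x0 \<noteq> v0" "x0 \<in> V" "v0 \<in> V"
    using J0E complete_edgesE by (metis subsetD)
  define P where "P = {(v, K). v \<in> V \<and> T_join V (sym_diff T (sym_diff {x0} {v})) K}"
  have "P \<subseteq> V \<times> Pow (complete_edges V)" by (auto simp: P_def T_join_def)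
  then have finP: "finite P" by (rule finite_subset) (use fin in simp)
  \<comment> \<open>Deleting \<open>e0\<close> from \<open>J0\<close> flips the parity at its two
    ends. This candidate makes the minimum over \<open>P\<close> strictly cheaper than
    \<open>J0\<close>.\<close>
  have P0: "(v0, sym_diff J0 {e0}) \<in> P"
    using T_join_sym_diff[OF fin T0 T_join_edge[of x0 v0 V] refl] x0 by (simp add: P_def)
  then have "P \<noteq> {}" by auto
  then obtain q where "is_arg_min (\<lambda>q. sum c (snd q)) (\<lambda>q. q \<in> P) q"
    using ex_is_arg_min_if_finite[OF finP] by blast
  moreover obtain b K where "q = (b, K)" by (cases q)
  ultimately have bK: "(b, K) \<in> P" and minK: "\<And>v L. (v, L) \<in> P \<Longrightarrow> sum c K \<le> sum c L"
    by (force simp: is_arg_min_linorder)+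
  have b: "b \<in> V" and TK: "T_join V (sym_diff T (sym_diff {x0} {b})) K"
    using bK by (auto simp: P_def)
  have finK: "finite K" and finJ0: "finite J0" using TK T0 fin T_join_finite by auto
  have "sum c K \<le> sum c J0 - c e0"
    using minK[OF P0] e0(1) finJ0 by (simp add: sum_diff insert_absorb)
  then have K_less: "sum c K < sum c J0" using e0 by simp
  define Z where "Z = {e \<in> complete_edges V. c e = 0}"
  define B where "B = {v \<in> V. (b, v) \<in> {(u, v). {u, v} \<in> Z}\<^sup>*}"
  have BV: "B \<subseteq> V" and bB: "b \<in> B" using b by (auto simp: B_def)
  have pos: "c e > 0" if "e \<in> cut V B" for e
  proof (rule ccontr)
    assume "\<not> c e > 0"
    moreover have "e \<in> complete_edges V" using that cut_subset by auto
    ultimately have "e \<in> Z" using c[of e] by (auto simp: Z_def)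
    moreover from that obtain u v where "e = {u, v}" "u \<in> B" "v \<notin> B" "v \<in> V" by (rule cutE) auto
    ultimately show False by (auto simp: B_def dest: rtrancl_into_rtrancl)
  qed
  have ZE: "Z \<subseteq> complete_edges V" by (auto simp: Z_def)
  have zero_path: "\<exists>Q. finite Q \<and> (\<forall>e\<in>Q. c e = 0) \<and> T_join V (sym_diff {b} {u}) Q"
    if u: "u \<in> B" for u
  proof -
    obtain Q where Q: "Q \<subseteq> Z" "T_join V (sym_diff {b} {u}) Q"
      using T_join_reachable[OF fin ZE, of b u] u by (auto simp: B_def)
    then show ?thesis using T_join_finite[OF fin Q(2)] by (intro exI[of _ Q]) (auto simp: Z_def)
  qed
  \<comment> \<open>If \<open>f\<close> left \<open>B\<close> at \<open>u\<close>, a free path from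
    \<open>b\<close> to \<open>u\<close> followed by deleting \<open>f\<close> would move the
    correction to the outer end \<open>w\<close> at a saving of \<open>c f\<close>. The claim covers
    every \<open>L\<close> as cheap as \<open>K\<close> because it is applied below to an exchanged
    join as well.\<close>
  have no_leave: "L \<inter> cut V B = {}" if L: "T_join V (sym_diff T (sym_diff {x0} {b})) L" "sum c L = sum c K" for L
  proof (rule ccontr)
    assume "L \<inter> cut V B \<noteq> {}"
    then obtain f where f: "f \<in> L" "f \<in> cut V B" by auto
    from f(2) obtain u w where uw: "f = {u, w}" "u \<in> V" "w \<in> V" "u \<in> B" "w \<notin> B" by (rule cutE) auto
    obtain Q where Q: "finite Q" "\<forall>e\<in>Q. c e = 0" "T_join V (sym_diff {b} {u}) Q"
      using zero_path uw by blast
    have finL: "finite L" using L(1) T_join_finite fin by auto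
    have fQ: "f \<in> sym_diff L Q" using f Q pos by force
    have "T_join V (sym_diff T (sym_diff {x0} {w})) (sym_diff (sym_diff L Q) {f})"
      unfolding uw(1) using uw
      by (intro T_join_sym_diff[OF fin T_join_sym_diff[OF fin L(1) Q(3) refl] T_join_edge]) auto
    then have "sum c K \<le> sum c (sym_diff (sym_diff L Q) {f})"
      using uw by (intro minK[of w]) (simp add: P_def)
    also have "\<dots> = sum c (sym_diff L Q) - c f"
      using fQ finL Q(1) by (subst sum_sym_diff) auto
    also have "\<dots> = sum c K - c f"
      using sum_sym_diff_zero[OF finL Q(1), of c] Q(2) L(2) by simp
    finally show False using pos[OF f(2)] by simp
  qed
  \<comment> \<open>Otherwise a free path from \<open>b\<close> to \<open>x0\<close> would turn
    \<open>K\<close> into a T-join cheaper than \<open>J0\<close>.\<close>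
  have x0B: "x0 \<notin> B"
  proof
    assume "x0 \<in> B"
    then obtain Q where Q: "finite Q" "\<forall>e\<in>Q. c e = 0" "T_join V (sym_diff {b} {x0}) Q"
      using zero_path by blast
    have "T_join V T (sym_diff K Q)"
      by (rule T_join_sym_diff[OF fin TK Q(3)]) auto
    from min0[OF this] K_less sum_sym_diff_zero[OF finK Q(1), of c] Q(2) show False by simp
  qed
  have odd: "odd (card (B \<inter> T))"
  proof -
    have "even (card (B \<inter> sym_diff T (sym_diff {x0} {b})))"
      using T_join_odd_cut[OF fin TK BV] no_leave[OF TK refl] by simp
    also have "B \<inter> sym_diff T (sym_diff {x0} {b}) = sym_diff (B \<inter> T) {b}"
      using x0B bB by auto
    also have "even (card (sym_diff (B \<inter> T) {b})) \<longleftrightarrow> (even (card (B \<inter> T)) \<longleftrightarrow> even (card {b}))"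
      using BV fin finite_subset by (intro even_card_sym_diff) auto
    finally show ?thesis by simp
  qed
  have "card (J \<inter> cut V B) = 1" if J: "min_cost_T_join V c T J" for J
  proof (rule ccontr)
    assume ne1: "card (J \<inter> cut V B) \<noteq> 1"
    have TJ: "T_join V T J" and minJ: "\<And>K. T_join V T K \<Longrightarrow> sum c J \<le> sum c K"
      using J by (auto simp: min_cost_T_join_def)
    have finJ: "finite J" using TJ T_join_finite fin by auto
    define D where "D = sym_diff J K"
    have TD: "T_join V (sym_diff {x0} {b}) D"
      unfolding D_def by (rule T_join_sym_diff[OF fin TJ TK]) auto
    then have DE: "D \<subseteq> complete_edges V" by (simp add: T_join_def)
    define D1 where "D1 = {e \<in> D. e \<inter> B = {}}"
    \<comment> \<open>\<open>C\<close> is the component of \<open>x0\<close> in the part of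
      \<open>D\<close> avoiding \<open>B\<close>. It contains exactly one of the two odd vertices
      \<open>x0\<close> and \<open>b\<close> of \<open>D\<close>, so some edge \<open>f\<close> of
      \<open>D\<close> leaves it, and by maximality \<open>f\<close> ends in
      \<open>B\<close>.\<close>
    define C where "C = {v \<in> V. (x0, v) \<in> {(u, v). {u, v} \<in> D1}\<^sup>*}"
    have CB: "C \<inter> B = {}"
    proof -
      have "v \<notin> B" if "(x0, v) \<in> {(u, v). {u, v} \<in> D1}\<^sup>*" for v
        using that x0B by (induction rule: rtrancl_induct) (auto simp: D1_def)
      then show ?thesis by (auto simp: C_def)
    qed
    have x0C: "x0 \<in> C" using x0 by (simp add: C_def)
    have CV: "C \<subseteq> V" by (auto simp: C_def)
    have "C \<inter> sym_diff {x0} {b} = {x0}" using x0C CB bB by auto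
    with T_join_odd_cut[OF fin TD CV] have "odd (card (D \<inter> cut V C))" by simp
    then have "D \<inter> cut V C \<noteq> {}" by auto
    then obtain f where f: "f \<in> D" "f \<in> cut V C" by auto
    from f(2) obtain w u where uw: "f = {w, u}" "w \<in> V" "u \<in> V" "w \<in> C" "u \<notin> C" by (rule cutE) auto
    have uB: "u \<in> B"
    proof (rule ccontr)
      assume "u \<notin> B"
      then have "{w, u} \<in> D1" using uw f CB by (auto simp: D1_def)
      with uw show False by (auto simp: C_def dest: rtrancl_into_rtrancl)
    qed
    obtain P1 where P1: "P1 \<subseteq> D1" "T_join V (sym_diff {x0} {w}) P1"
      using T_join_reachable[OF fin, of D1 x0 w] DE uw by (auto simp: C_def D1_def)
    obtain Q where Q: "finite Q" "\<forall>e\<in>Q. c e = 0" "T_join V (sym_diff {b} {u}) Q"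
      using zero_path uB by blast
    have fE: "{w, u} \<in> complete_edges V" using f DE uw by blast
    \<comment> \<open>Removing from \<open>D\<close> a path from \<open>x0\<close> to
      \<open>w\<close> and the edge \<open>f\<close> leaves \<open>b\<close> and \<open>u\<close> as
      the only possible odd vertices. The free path \<open>Q\<close> joins them, so adding it makes
      all degrees even.\<close>
    define Z' where "Z' = sym_diff D (sym_diff P1 {f})"
    have "T_join V (sym_diff {b} {u}) Z'"
      unfolding Z'_def uw(1)
      by (rule T_join_sym_diff[OF fin TD T_join_sym_diff[OF fin P1(2) T_join_edge[OF fE] refl]])
        (use CB uw uB bB in auto)
    then have TZ: "T_join V {} (sym_diff Z' Q)"
      by (rule T_join_sym_diff[OF fin _ Q(3)]) auto
    have Z'D: "Z' \<subseteq> D" using P1(1) f by (auto simp: Z'_def D1_def)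
    have finD: "finite D" using TD T_join_finite fin by auto
    then have finZ': "finite Z'" using Z'D finite_subset by auto
    have assoc: "sym_diff A (sym_diff Z' Q) = sym_diff (sym_diff A Z') Q" for A by auto
    have cost: "sum c (sym_diff A (sym_diff Z' Q)) = sum c (sym_diff A Z')" if "finite A" for A
      unfolding assoc using sum_sym_diff_zero[of "sym_diff A Z'" Q c] that finZ' Q by auto
    have "sum c Z' = sum c (J \<inter> Z') + sum c (K \<inter> Z')"
      using finJ finK Z'D by (subst sum.union_disjoint[symmetric])
        (auto simp: D_def intro!: arg_cong2[where f = sum])
    \<comment> \<open>As \<open>Z'\<close> lies in the symmetric difference of \<open>J\<close> and
      \<open>K\<close>, exchanging along it hands each of its edges from one join to the other and
      keeps the total cost. Neither join can become cheaper, so both costs stay the same.\<close>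
    then have swap: "sum c (sym_diff J Z') + sum c (sym_diff K Z') = sum c J + sum c K"
      using finJ finK finZ' by (simp add: sum_sym_diff)
    have "T_join V T (sym_diff J (sym_diff Z' Q))"
      by (rule T_join_sym_diff[OF fin TJ TZ]) auto
    then have "sum c J \<le> sum c (sym_diff J Z')" using minJ[of "sym_diff J (sym_diff Z' Q)"] cost[OF finJ] by simp
    moreover have TK': "T_join V (sym_diff T (sym_diff {x0} {b})) (sym_diff K (sym_diff Z' Q))"
      by (rule T_join_sym_diff[OF fin TK TZ]) auto
    then have "sum c K \<le> sum c (sym_diff K Z')"
      using minK[of b "sym_diff K (sym_diff Z' Q)"] b cost[OF finK] by (simp add: P_def)
    ultimately have "sum c (sym_diff K (sym_diff Z' Q)) = sum c K"
      using swap cost[OF finK] by simp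
    then have empty: "sym_diff K (sym_diff Z' Q) \<inter> cut V B = {}"
      using no_leave[OF TK'] by simp
    have "odd (card (J \<inter> cut V B))"
      using T_join_odd_cut[OF fin TJ BV] odd by simp
    \<comment> \<open>An odd number other than 1 is at least 3, so an edge \<open>g\<close> besides
      \<open>f\<close> crosses the cut. It survives the exchange into \<open>K\<close>,
      contradicting \<open>no_leave\<close>.\<close>
    then have "\<not> J \<inter> cut V B \<subseteq> {f}"
      using ne1 by (auto dest: subset_singletonD)
    then obtain g where g: "g \<in> J" "g \<in> cut V B" "g \<noteq> f" by auto
    have "g \<notin> K" using no_leave[OF TK refl] g by auto
    moreover have "g \<notin> P1" using g(2) P1(1) by (auto simp: D1_def elim!: cutE)
    moreover have "g \<notin> Q" using g(2) pos Q(2) by force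
    ultimately have "g \<in> sym_diff K (sym_diff Z' Q)" using g by (auto simp: Z'_def D_def)
    with empty g show False by auto
  qed
  with that BV odd pos show ?thesis by blast
qed

text \<open>Here \<open>\<epsilon>\<close> is the largest uniform decrease on the cut that keeps its
  costs nonnegative and \<open>J0\<close> optimal. The final disjunction records which of the two
  limits is reached.\<close>

lemma exists_cut_reduction:
  fixes c :: "'a set \<Rightarrow> real"
  assumes fin: "finite V"
    and c: "\<And>e. e \<in> complete_edges V \<Longrightarrow> c e \<ge> 0"
    and J0: "min_cost_T_join V c T J0" "sum c J0 > 0"
  obtains B \<epsilon> where "B \<subseteq> V" "odd (card (B \<inter> T))" "\<epsilon> > 0"
    "\<And>e. e \<in> cut V B \<Longrightarrow> \<epsilon> \<le> c e"
    "\<And>K. T_join V T K \<Longrightarrow> sum c J0 - \<epsilon> \<le> sum c K - \<epsilon> * card (K \<inter> cut V B)"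
    "\<And>J. min_cost_T_join V c T J \<Longrightarrow> card (J \<inter> cut V B) = 1"
    "(\<exists>e\<in>cut V B. c e = \<epsilon>) \<or>
     (\<exists>K. T_join V T K \<and> sum c K > sum c J0 \<and>
        sum c J0 - \<epsilon> = sum c K - \<epsilon> * card (K \<inter> cut V B))"
proof -
  obtain B where B: "B \<subseteq> V" "odd (card (B \<inter> T))" "\<And>e. e \<in> cut V B \<Longrightarrow> c e > 0"
    "\<And>J. min_cost_T_join V c T J \<Longrightarrow> card (J \<inter> cut V B) = 1"
    using exists_tight_odd_cut[OF fin c J0] by metis
  have T0: "T_join V T J0" and min0: "\<And>K. T_join V T K \<Longrightarrow> sum c J0 \<le> sum c K"
    using J0(1) by (auto simp: min_cost_T_join_def)
  define n where "n K = card (K \<inter> cut V B)" for K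
  define \<K> where "\<K> = {K. T_join V T K \<and> n K > 1}"
  \<comment> \<open>A join crossing the cut \<open>n K\<close> times gains on \<open>J0\<close>,
    which crosses once, at rate \<open>n K - 1\<close>. Thus \<open>r K\<close> is the decrease at
    which \<open>K\<close> catches up.\<close>
  define r where "r K = (sum c K - sum c J0) / (real (n K) - 1)" for K
  define M where "M = c ` cut V B \<union> r ` \<K>"
  have "\<K> \<subseteq> Pow (complete_edges V)" by (auto simp: \<K>_def T_join_def)
  then have "finite \<K>" using fin by (meson finite_Pow_iff finite_complete_edges finite_subset)
  then have finM: "finite M" using fin by (simp add: M_def)
  have "cut V B \<noteq> {}" using B(4)[OF J0(1)] by auto
  then have M0: "M \<noteq> {}" by (simp add: M_def)
  have \<K>_less: "sum c K > sum c J0" if "K \<in> \<K>" for K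
  proof (rule ccontr)
    assume "\<not> sum c K > sum c J0"
    then have "min_cost_T_join V c T K"
      using that min0 by (force simp: \<K>_def min_cost_T_join_def)
    with B(4) that show False by (force simp: \<K>_def n_def)
  qed
  define \<epsilon> where "\<epsilon> = Min M"
  have \<epsilon>M: "\<epsilon> \<in> M" and \<epsilon>_le: "\<And>m. m \<in> M \<Longrightarrow> \<epsilon> \<le> m" using finM M0 by (auto simp: \<epsilon>_def)
  have "\<epsilon> > 0" using \<epsilon>M B(3) \<K>_less by (auto simp: M_def r_def \<K>_def)
  have bound: "sum c J0 - \<epsilon> \<le> sum c K - \<epsilon> * n K" if K: "T_join V T K" for K
  proof (cases "n K > 1")
    case True
    then have "\<epsilon> \<le> r K" using K by (intro \<epsilon>_le) (auto simp: M_def \<K>_def)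
    then show ?thesis using True by (simp add: r_def field_simps)
  next
    case False
    have "odd (n K)" using T_join_odd_cut[OF fin K B(1)] B(2) by (simp add: n_def)
    with False have "n K = 1" by (cases "n K") auto
    then show ?thesis using min0[OF K] by simp
  qed
  have "\<exists>K. T_join V T K \<and> sum c K > sum c J0 \<and> sum c J0 - \<epsilon> = sum c K - \<epsilon> * n K"
    if not_edge: "\<epsilon> \<notin> c ` cut V B"
  proof -
    obtain K where K: "K \<in> \<K>" "\<epsilon> = r K" using not_edge \<epsilon>M unfolding M_def by blast
    then have "sum c J0 - \<epsilon> = sum c K - \<epsilon> * n K" by (simp add: \<K>_def r_def field_simps)
    with K \<K>_less show ?thesis by (auto simp: \<K>_def)
  qed
  then show ?thesis
    using that[of B \<epsilon>] B \<open>\<epsilon> > 0\<close> \<epsilon>_le bound unfolding n_def M_def by blast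
qed

text \<open>Edmonds and Johnson's bound for the T-join polyhedron. Lowering the cost on a tight odd cut
  until an edge cost vanishes or a new optimal join appears keeps all optimal joins optimal, so the
  number of positive edges and non-optimal joins drops.\<close>

lemma min_cost_T_join_le_fractional:
  fixes c y :: "'a set \<Rightarrow> real"
  assumes fin: "finite V"
    and c: "\<And>e. e \<in> complete_edges V \<Longrightarrow> c e \<ge> 0"
    and y: "\<And>e. e \<in> complete_edges V \<Longrightarrow> y e \<ge> 0"
    and odd_cut: "\<And>S. S \<subseteq> V \<Longrightarrow> odd (card (S \<inter> T)) \<Longrightarrow> sum y (cut V S) \<ge> 1"
    and J: "min_cost_T_join V c T J"
  shows "sum c J \<le> cost_vec V c y"
  using c J
proof (induction "card {e \<in> complete_edges V. c e > 0} +
    card {K. T_join V T K \<and> \<not> min_cost_T_join V c T K}" arbitrary: c rule: less_induct)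
  case less
  note c = less.prems(1) and J = less.prems(2)
  show ?case
  proof (cases "sum c J > 0")
    case False
    have "cost_vec V c y \<ge> 0"
      unfolding cost_vec_def using c y by (intro sum_nonneg mult_nonneg_nonneg)
    with False show ?thesis by simp
  next
    case True
    obtain B \<epsilon> where B: "B \<subseteq> V" "odd (card (B \<inter> T))" and \<epsilon>: "\<epsilon> > 0"
        "\<And>e. e \<in> cut V B \<Longrightarrow> \<epsilon> \<le> c e"
      and bound: "\<And>K. T_join V T K \<Longrightarrow> sum c J - \<epsilon> \<le> sum c K - \<epsilon> * card (K \<inter> cut V B)"
      and one: "\<And>J. min_cost_T_join V c T J \<Longrightarrow> card (J \<inter> cut V B) = 1"
      and tight: "(\<exists>e\<in>cut V B. c e = \<epsilon>) \<or>
        (\<exists>K. T_join V T K \<and> sum c K > sum c J \<and>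
          sum c J - \<epsilon> = sum c K - \<epsilon> * card (K \<inter> cut V B))"
      using exists_cut_reduction[OF fin c J True] by metis
    define c' where "c' e = c e - \<epsilon> * indicator (cut V B) e" for e
    have c'_nonneg: "c' e \<ge> 0" if "e \<in> complete_edges V" for e
      using c[OF that] \<epsilon>(2)[of e] by (auto simp: c'_def indicator_def)
    have c'_sum: "sum c' K = sum c K - \<epsilon> * card (K \<inter> cut V B)" if "T_join V T K" for K
      using T_join_finite[OF fin that]
      by (simp add: c'_def sum_subtractf indicator_def flip: sum_distrib_left)
    have TJ: "T_join V T J" using J by (simp add: min_cost_T_join_def)
    \<comment> \<open>\<open>J\<close> crosses the cut exactly once, so its reduced cost
      \<open>sum c J - \<epsilon>\<close> attains the lower bound on all T-joins.\<close>
    have J'_iff: "min_cost_T_join V c' T K \<longleftrightarrow> T_join V T K \<and> sum c' K = sum c J - \<epsilon>" for K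
    proof -
      have "sum c' J = sum c J - \<epsilon>" using c'_sum[OF TJ] one[OF J] by simp
      with bound c'_sum TJ show ?thesis
        unfolding min_cost_T_join_def by (metis order_antisym)
    qed
    have keep: "min_cost_T_join V c' T K" if K: "min_cost_T_join V c T K" for K
    proof -
      have "T_join V T K" "sum c K = sum c J"
        using K J by (auto simp: min_cost_T_join_def intro: order_antisym)
      then show ?thesis using J'_iff c'_sum one[OF K] by simp
    qed
    define P where "P c = {e \<in> complete_edges V. c e > 0}" for c :: "'a set \<Rightarrow> real"
    define N where "N c = {K. T_join V T K \<and> \<not> min_cost_T_join V c T K}" for c
    have sub: "P c' \<subseteq> P c" "N c' \<subseteq> N c"
      using keep \<epsilon>(1) by (auto simp: P_def N_def c'_def indicator_def split: if_splits)
    have "N c \<subseteq> Pow (complete_edges V)" by (auto simp: N_def T_join_def)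
    then have finEN: "finite (P c)" "finite (N c)"
      using fin by (auto simp: P_def intro: finite_subset)
    have "P c' \<noteq> P c \<or> N c' \<noteq> N c"
      using tight
    proof
      assume "\<exists>e\<in>cut V B. c e = \<epsilon>"
      then obtain e where e: "e \<in> cut V B" "c e = \<epsilon>" by auto
      then have "e \<in> P c" "e \<notin> P c'"
        using \<epsilon>(1) cut_subset[of V B] by (auto simp: P_def c'_def)
      then show ?thesis by blast
    next
      assume "\<exists>K. T_join V T K \<and> sum c K > sum c J \<and>
          sum c J - \<epsilon> = sum c K - \<epsilon> * card (K \<inter> cut V B)"
      then obtain K where K: "T_join V T K" "sum c K > sum c J"
          "sum c J - \<epsilon> = sum c K - \<epsilon> * card (K \<inter> cut V B)"
        by auto
      then have "min_cost_T_join V c' T K" using J'_iff c'_sum by simp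
      moreover have "\<not> min_cost_T_join V c T K" using K TJ by (force simp: min_cost_T_join_def)
      ultimately have "K \<in> N c" "K \<notin> N c'" using K by (auto simp: N_def)
      then show ?thesis by blast
    qed
    then have "P c' \<subset> P c \<or> N c' \<subset> N c"
      using psubsetI[OF sub(1)] psubsetI[OF sub(2)] by argo
    then have "card (P c') < card (P c) \<or> card (N c') < card (N c)"
      using psubset_card_mono[OF finEN(1)] psubset_card_mono[OF finEN(2)] by metis
    moreover have "card (P c') \<le> card (P c)" "card (N c') \<le> card (N c)"
      using card_mono[OF finEN(1) sub(1)] card_mono[OF finEN(2) sub(2)] .
    ultimately have "card (P c') + card (N c') < card (P c) + card (N c)"
      by linarith
    then have IH: "sum c' J \<le> cost_vec V c' y"
      using less.hyps[of c', OF _ c'_nonneg keep[OF J]] by (simp add: P_def N_def)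
    have "cost_vec V c' y = cost_vec V c y - \<epsilon> * (\<Sum>e\<in>complete_edges V. indicator (cut V B) e * y e)"
      by (simp add: cost_vec_def c'_def algebra_simps sum_subtractf sum_distrib_left)
    also have "(\<Sum>e\<in>complete_edges V. indicator (cut V B) e * y e) = sum y (cut V B)"
      using fin cut_subset[of V B]
      by (intro sum.mono_neutral_cong_right) (auto simp: indicator_def)
    finally have "sum c J - \<epsilon> \<le> cost_vec V c y - \<epsilon> * sum y (cut V B)"
      using IH c'_sum[OF TJ] one[OF J] by simp
    \<comment> \<open>The odd-cut constraint at \<open>B\<close> makes the fractional cost drop by
      at least the amount \<open>\<epsilon>\<close> lost by \<open>J\<close>.\<close>
    moreover have "\<epsilon> * 1 \<le> \<epsilon> * sum y (cut V B)"
      using odd_cut[OF B] \<epsilon>(1) by (intro mult_left_mono) auto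
    ultimately show ?thesis by simp
  qed
qed

section \<open>Walks and shortcuts\<close>

lemma walk_edges_simps [simp]:
  "walk_edges [] = []" "walk_edges [u] = []"
  "walk_edges (u # v # vs) = {u, v} # walk_edges (v # vs)"
  by (simp_all add: walk_edges_def)

lemma walk_cost_simps [simp]:
  "walk_cost c [] = 0" "walk_cost c [u] = 0"
  "walk_cost c (u # v # vs) = c {u, v} + walk_cost c (v # vs)"
  by (simp_all add: walk_cost_def)

lemma walk_crosses_cut:
  assumes "set (walk_edges (u # vs)) \<subseteq> F" "F \<subseteq> complete_edges V" "u \<in> S" "last (u # vs) \<notin> S"
  shows "F \<inter> cut V S \<noteq> {}"
  using assms
proof (induction vs arbitrary: u)
  case (Cons w vs)
  have uw: "{u, w} \<in> F" using Cons.prems(1) by simp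
  then have "{u, w} \<in> complete_edges V" using Cons.prems(2) by blast
  with uw have "w \<notin> S \<Longrightarrow> {u, w} \<in> F \<inter> cut V S"
    using Cons.prems(3) by (auto simp: doubleton_in_cut)
  moreover have "w \<in> S \<Longrightarrow> ?case" using Cons.IH[of w] Cons.prems by simp
  ultimately show ?case by blast
qed simp

lemma spanning_tree_crosses_cut:
  assumes "is_spanning_tree V F" "S \<subseteq> V" "S \<noteq> {}" "S \<noteq> V"
  shows "F \<inter> cut V S \<noteq> {}"
proof -
  obtain u v where uv: "u \<in> S" "u \<in> V" "v \<in> V" "v \<notin> S" using assms(2-4) by auto
  then obtain vs where vs: "joins vs u v" "set (walk_edges vs) \<subseteq> F"
    using assms(1) unfolding is_spanning_tree_def connected_on_def by blast
  then obtain ws where "vs = u # ws" by (cases vs) (auto simp: joins_def)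
  with walk_crosses_cut[of u ws F V S] vs uv assms(1) show ?thesis
    by (auto simp: is_spanning_tree_def joins_def)
qed

text \<open>Each deleted vertex is bypassed by the triangle inequality, or dropped by nonnegativity
  at the end of the walk. The first vertex \<open>a\<close> is held fixed so that the induction
  always has a predecessor to bypass from.\<close>

lemma walk_cost_subseq:
  assumes nonneg: "\<And>u v. u \<in> V \<Longrightarrow> v \<in> V \<Longrightarrow> d {u, v} \<ge> 0"
    and triangle: "\<And>u v w. u \<in> V \<Longrightarrow> v \<in> V \<Longrightarrow> w \<in> V \<Longrightarrow> d {u, w} \<le> d {u, v} + d {v, w}"
    and "subseq xs ys" "a \<in> V" "set ys \<subseteq> V"
  shows "walk_cost d (a # xs) \<le> walk_cost d (a # ys)"
  using assms(3-5)
proof (induction arbitrary: a rule: list_emb.induct)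
  case (list_emb_Nil ys)
  then show ?case
  proof (induction ys arbitrary: a)
    case (Cons y ys)
    then show ?case using nonneg[of a y] Cons.IH[of y] by simp
  qed simp
next
  case (list_emb_Cons xs ys y)
  have "walk_cost d (a # xs) \<le> walk_cost d (a # ys)" using list_emb_Cons by simp
  also have "\<dots> \<le> walk_cost d (a # y # ys)"
  proof (cases ys)
    case Nil
    then show ?thesis using nonneg[of a y] list_emb_Cons.prems by simp
  next
    case (Cons z zs)
    then show ?thesis using triangle[of a y z] list_emb_Cons.prems by simp
  qed
  finally show ?case .
next
  case (list_emb_Cons2 x y xs ys)
  then show ?case by simp
qed

lemma walk_vertices:
  assumes "set (walk_edges (u # vs)) \<subseteq> complete_edges V" "u \<in> V"
  shows "set vs \<subseteq> V"
  using assms by (induction vs arbitrary: u) auto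

lemma walk_edges_distinct:
  assumes "distinct vs" "set vs \<subseteq> V"
  shows "set (walk_edges vs) \<subseteq> complete_edges V"
  using assms by (induction vs rule: induct_list012) auto

text \<open>A shortcut may skip a closed part of the walk, so the triangle inequality is used for
  the cost that is zero on one-element sets.\<close>

lemma walk_cost_shortcut:
  assumes fin: "finite V" and s: "s \<in> V" and c: "metric_cost V c"
    and F: "F \<subseteq> complete_edges V" and J: "J \<subseteq> complete_edges V"
    and W: "eulerian_path (mset_set F + mset_set J) s t W"
    and H: "shortcut_path V s t W H"
  shows "walk_cost c H \<le> sum c F + sum c J"
proof -
  define d where "d e = (if card e = 2 then c e else 0)" for e
  have d_edge: "d {u, v} = (if u = v then 0 else c {u, v})" for u v
    by (simp add: d_def)
  have d_walk: "walk_cost d vs = walk_cost c vs" if "set (walk_edges vs) \<subseteq> complete_edges V" for vs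
    using that unfolding walk_cost_def
    by (intro arg_cong[where f = sum_list] map_cong) (auto simp: d_def complete_edges_def)
  have finFJ: "finite F" "finite J"
    using F J fin by (auto intro: finite_subset)
  have mW: "mset (walk_edges W) = mset_set F + mset_set J" using W by (simp add: eulerian_path_def)
  then have eW: "set (walk_edges W) \<subseteq> complete_edges V"
    using F J finFJ by (metis Un_subset_iff finite_set_mset_mset_set set_mset_mset set_mset_union)
  obtain W' where W': "W = s # W'" using W by (cases W) (auto simp: eulerian_path_def joins_def)
  have hH: "hamiltonian_path V s t H" and sH: "subseq H W" using H by (auto simp: shortcut_path_def)
  obtain H' where H': "H = s # H'" using hH by (cases H) (auto simp: hamiltonian_path_def joins_def)
  have eH: "set (walk_edges H) \<subseteq> complete_edges V"
    using hH by (intro walk_edges_distinct) (auto simp: hamiltonian_path_def)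
  have "walk_cost c H = walk_cost d (s # H')" using d_walk[OF eH] H' by simp
  also have "\<dots> \<le> walk_cost d (s # W')"
  proof (rule walk_cost_subseq[where V = V])
    show "d {u, v} \<ge> 0" if "u \<in> V" "v \<in> V" for u v
      using c that by (auto simp: d_edge metric_cost_def)
    show "d {u, w} \<le> d {u, v} + d {v, w}" if "u \<in> V" "v \<in> V" "w \<in> V" for u v w
      using c that by (auto simp: d_edge metric_cost_def insert_commute)
    show "subseq H' W'" using sH H' W' by simp
    show "set W' \<subseteq> V" using walk_vertices eW W' s by metis
  qed (rule s)
  also have "\<dots> = walk_cost c W" using d_walk[OF eW] W' by simp
  also have "\<dots> = sum_mset (image_mset c (mset (walk_edges W)))"
    by (simp add: walk_cost_def sum_mset_sum_list flip: mset_map)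
  also have "\<dots> = sum c F + sum c J" by (simp add: mW sum_unfold_sum_mset)
  finally show ?thesis .
qed

section \<open>Narrow cuts\<close>

lemma cut_sym_diff: "cut V (sym_diff A B) = sym_diff (cut V A) (cut V B)"
proof -
  have "e \<in> cut V (sym_diff A B) \<longleftrightarrow> e \<in> sym_diff (cut V A) (cut V B)"
    if "e \<in> complete_edges V" for e
    using that by (elim complete_edgesE) (auto simp: doubleton_in_cut)
  with cut_subset[of V] show ?thesis by blast
qed

lemma sum_cut_eq:
  fixes x :: "'a set \<Rightarrow> real"
  assumes "finite V"
  shows "sum x (cut V S) = (\<Sum>e\<in>complete_edges V. x e * indicator (cut V S) e)"
  using assms cut_subset[of V S]
  by (intro sum.mono_neutral_cong_left) (auto simp: indicator_def)

text \<open>Posimodularity of the cut function, checked edge by edge according to the positions of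
  the two endpoints.\<close>

lemma cut_uncross:
  fixes x :: "'a set \<Rightarrow> real"
  assumes "finite V" "\<And>e. e \<in> complete_edges V \<Longrightarrow> x e \<ge> 0"
  shows "sum x (cut V (A - B)) + sum x (cut V (B - A)) \<le> sum x (cut V A) + sum x (cut V B)"
  unfolding sum_cut_eq[OF assms(1)] sum.distrib[symmetric] distrib_left[symmetric]
proof (intro sum_mono mult_left_mono)
  fix e assume "e \<in> complete_edges V"
  then obtain u v where "e = {u, v}" "u \<noteq> v" "u \<in> V" "v \<in> V" by (rule complete_edgesE)
  then show "indicat_real (cut V (A - B)) e + indicat_real (cut V (B - A)) e
      \<le> indicat_real (cut V A) e + indicat_real (cut V B) e"
    by (cases "u \<in> A"; cases "u \<in> B"; cases "v \<in> A"; cases "v \<in> B")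
      (simp_all add: indicator_def doubleton_in_cut)
qed (use assms in auto)

lemma held_karp_cut_st:
  assumes "held_karp_feasible V s t x" "t \<in> V" "U \<subseteq> V" "s \<in> U" "t \<notin> U"
  shows "sum x (cut V U) \<ge> 1"
proof -
  have "U \<inter> {s, t} = {s}" "U \<subset> V" using assms by auto
  then show ?thesis using assms(1) by (simp add: held_karp_feasible_def)
qed

lemma held_karp_cut_nonst:
  assumes "held_karp_feasible V s t x" "s \<in> V" "U \<subseteq> V" "U \<noteq> {}" "s \<notin> U" "t \<notin> U"
  shows "sum x (cut V U) \<ge> 2"
proof -
  have "U \<inter> {s, t} = {}" "U \<subset> V" using assms by auto
  then show ?thesis using assms(1,4) by (simp add: held_karp_feasible_def)
qed

section \<open>The chain of narrow cuts and its layers\<close>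

locale held_karp_point =
  fixes V :: "'a set" and s t :: 'a and x :: "'a set \<Rightarrow> real" and \<tau> :: real
  assumes fin: "finite V" and s: "s \<in> V" and t: "t \<in> V" and st: "s \<noteq> t"
    and feasible: "held_karp_feasible V s t x"
    and \<tau>: "0 \<le> \<tau>" "\<tau> \<le> 1"
begin

text \<open>Each cut is represented by its side containing \<open>s\<close>, so that it occurs once
  and inclusion compares cuts.\<close>

definition narrow_cuts :: "'a set set" where
  "narrow_cuts = {U. U \<subset> V \<and> s \<in> U \<and> t \<notin> U \<and> sum x (cut V U) < 1 + \<tau>}"

text \<open>The predecessor of \<open>U\<close> in the chain of narrow cuts, or the empty set if
  \<open>U\<close> is the smallest.\<close>

definition lower :: "'a set \<Rightarrow> 'a set" where
  "lower U = \<Union>{A \<in> narrow_cuts. A \<subset> U}"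

definition layer_edges :: "'a set \<Rightarrow> 'a set set" where
  "layer_edges U = {e \<in> cut V U. e \<inter> lower U = {}}"

lemma x_nonneg: "e \<in> complete_edges V \<Longrightarrow> x e \<ge> 0"
  using feasible by (simp add: held_karp_feasible_def)

lemma finite_narrow_cuts: "finite narrow_cuts"
  by (rule finite_subset[of _ "Pow V"]) (use fin in \<open>auto simp: narrow_cuts_def\<close>)

text \<open>If two narrow cuts crossed, both differences would avoid \<open>s\<close> and
  \<open>t\<close> and have weight at least 2, whereas uncrossing bounds their total by something
  below \<open>2 + 2 * \<tau>\<close>, hence below 4.\<close>

lemma narrow_cuts_chain:
  assumes "A \<in> narrow_cuts" "B \<in> narrow_cuts"
  shows "A \<subseteq> B \<or> B \<subseteq> A"
proof (rule ccontr)
  assume "\<not> ?thesis"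
  then have "A - B \<noteq> {}" "B - A \<noteq> {}" by auto
  then have "sum x (cut V (A - B)) \<ge> 2" "sum x (cut V (B - A)) \<ge> 2"
    using assms s by (auto simp: narrow_cuts_def intro!: held_karp_cut_nonst[OF feasible])
  moreover have "sum x (cut V A) < 1 + \<tau>" "sum x (cut V B) < 1 + \<tau>"
    using assms by (auto simp: narrow_cuts_def)
  ultimately show False
    using cut_uncross[of V x A B] fin x_nonneg \<tau> by fastforce
qed

lemma lower_narrow_cuts:
  assumes "lower U \<noteq> {}"
  shows "lower U \<in> narrow_cuts" "lower U \<subset> U"
proof -
  let ?A = "{A \<in> narrow_cuts. A \<subset> U}"
  have "?A \<noteq> {}" using assms by (auto simp: lower_def)
  moreover have "finite ?A" using finite_narrow_cuts by simp
  moreover have "A \<union> B \<in> ?A" if "A \<in> ?A" "B \<in> ?A" for A B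
    using narrow_cuts_chain[of A B] that by (auto simp: Un_absorb1 Un_absorb2)
  ultimately have "\<Union>?A \<in> ?A" by (intro finite_Sup_in) auto
  then show "lower U \<in> narrow_cuts" "lower U \<subset> U" by (auto simp: lower_def)
qed

text \<open>Writing \<open>P\<close> for the next smaller narrow cut, the constraint of \<open>U - P\<close> bounds the weight
  crossing both \<open>P\<close> and \<open>U\<close>, as \<open>U - P\<close> separates neither \<open>s\<close> nor \<open>t\<close>.\<close>

lemma layer_edges_weight:
  assumes U: "U \<in> narrow_cuts"
  shows "sum x (layer_edges U) \<ge> 1 - \<tau> / 2"
proof -
  have U1: "sum x (cut V U) \<ge> 1"
    using U t by (intro held_karp_cut_st[OF feasible]) (auto simp: narrow_cuts_def)
  show ?thesis
  proof (cases "lower U = {}")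
    case True
    then have "layer_edges U = cut V U" by (simp add: layer_edges_def)
    then show ?thesis using U1 \<tau> by simp
  next
    case False
    define P where "P = lower U"
    have P: "P \<in> narrow_cuts" "P \<subset> U" using lower_narrow_cuts[OF False] by (auto simp: P_def)
    \<comment> \<open>An edge leaving \<open>U\<close> has its outer end outside \<open>P\<close>,
      so it meets \<open>P\<close> exactly when it crosses \<open>P\<close>.\<close>
    have "e \<inter> P = {} \<longleftrightarrow> e \<notin> cut V P" if "e \<in> cut V U" for e
      using that P(2) by (elim cutE) (auto simp: doubleton_in_cut)
    then have "layer_edges U = cut V U - cut V P \<inter> cut V U"
      by (auto simp: layer_edges_def P_def)
    then have F: "sum x (layer_edges U) = sum x (cut V U) - sum x (cut V P \<inter> cut V U)"
      using fin by (simp add: sum_diff)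
    have "sum x (cut V (U - P)) \<ge> 2"
      using P U s by (intro held_karp_cut_nonst[OF feasible]) (auto simp: narrow_cuts_def)
    also have "U - P = sym_diff U P" using P by auto
    also have "sum x (cut V (sym_diff U P)) =
        sum x (cut V U) + sum x (cut V P) - 2 * sum x (cut V P \<inter> cut V U)"
      unfolding cut_sym_diff using fin by (subst sum_sym_diff) (auto simp: Int_commute)
    finally have "2 * sum x (cut V P \<inter> cut V U) \<le> sum x (cut V U) + sum x (cut V P) - 2" by simp
    moreover have "sum x (cut V P) < 1 + \<tau>" using P by (simp add: narrow_cuts_def)
    ultimately show ?thesis using F U1 by simp
  qed
qed

text \<open>If \<open>A\<close> is the smaller cut, an edge of its layer has an endpoint in
  \<open>A\<close>, which lies in \<open>lower B\<close>, and the layer of \<open>B\<close> avoids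
  that set.\<close>

lemma layer_edges_disjoint:
  assumes "A \<in> narrow_cuts" "B \<in> narrow_cuts" "A \<noteq> B"
  shows "layer_edges A \<inter> layer_edges B = {}"
proof -
  have *: "layer_edges A \<inter> layer_edges B = {}" if "A \<in> narrow_cuts" "A \<subset> B" for A B
  proof -
    have "A \<subseteq> lower B" using that by (auto simp: lower_def)
    then show ?thesis by (fastforce simp: layer_edges_def elim: cutE)
  qed
  show ?thesis using narrow_cuts_chain[OF assms(1,2)] *[of A B] *[of B A] assms by blast
qed

lemma layer_edges_subset: "layer_edges U \<subseteq> complete_edges V"
  using cut_subset by (auto simp: layer_edges_def)

lemma sum_layer_edges_le:
  fixes f :: "'a set \<Rightarrow> real"
  assumes "\<And>e. e \<in> complete_edges V \<Longrightarrow> f e \<ge> 0"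
  shows "(\<Sum>U\<in>narrow_cuts. sum f (layer_edges U)) \<le> sum f (complete_edges V)"
proof -
  have "(\<Sum>U\<in>narrow_cuts. sum f (layer_edges U)) = sum f (\<Union>U\<in>narrow_cuts. layer_edges U)"
    using finite_narrow_cuts layer_edges_disjoint finite_subset[OF layer_edges_subset] fin
    by (intro sum.UNION_disjoint[symmetric]) auto
  also have "\<dots> \<le> sum f (complete_edges V)"
    using fin assms layer_edges_subset by (intro sum_mono2) auto
  finally show ?thesis .
qed

text \<open>The set \<open>wrong_parity V s t F\<close> is the set of odd-degree vertices of
  \<open>F\<close> with membership of \<open>s\<close> and \<open>t\<close> flipped.\<close>

lemma odd_card_wrong_parity:
  assumes F: "F \<subseteq> complete_edges V" and S: "S \<subseteq> V"
  shows "odd (card (S \<inter> wrong_parity V s t F)) \<longleftrightarrow>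
    odd (card (F \<inter> cut V S)) \<noteq> odd (card (S \<inter> {s, t}))"
proof -
  have "S \<inter> wrong_parity V s t F = sym_diff {v \<in> S. odd (edge_degree F v)} (S \<inter> {s, t})"
    using S s t by (auto simp: wrong_parity_def)
  moreover have "finite S" using S fin finite_subset by auto
  ultimately show ?thesis
    using odd_card_odd_degrees[OF fin F S] by (simp add: even_card_sym_diff)
qed

text \<open>The fractional join is \<open>a\<close> times the tree plus \<open>b\<close> times \<open>x\<close>. An odd cut separating \<open>s\<close>
  from \<open>t\<close> meets the tree in an even number of edges, so this can only fail to cover narrow
  cuts, and those are repaired by \<open>g\<close> times the \<open>x\<close>-weight of their private layers.\<close>

lemma min_cost_T_join_le_tree:
  fixes c :: "'a set \<Rightarrow> real"
  assumes c: "\<And>e. e \<in> complete_edges V \<Longrightarrow> c e \<ge> 0"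
    and tree: "is_spanning_tree V F"
    and J: "min_cost_T_join V c (wrong_parity V s t F) J"
    and coeffs: "a \<ge> 0" "b \<ge> 0" "g \<ge> 0" "a + 2 * b \<ge> 1" "2 * a + b * (1 + \<tau>) \<ge> 1"
      "2 * a + b + g * (1 - \<tau> / 2) \<ge> 1"
  shows "sum c J \<le> a * sum c F + b * cost_vec V c x +
    g * (\<Sum>U\<in>narrow_cuts. of_bool (even (card (F \<inter> cut V U))) * (\<Sum>e\<in>layer_edges U. c e * x e))"
proof -
  let ?L = layer_edges and ?T = "wrong_parity V s t F"
  define h where "h U = (of_bool (even (card (F \<inter> cut V U))) :: real)" for U
  have h: "h U \<ge> 0" for U by (simp add: h_def)
  define z where "z e = (\<Sum>U\<in>narrow_cuts. h U * (indicator (?L U) e * x e))" for e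
  define y where "y e = a * indicator F e + b * x e + g * z e" for e
  have F: "F \<subseteq> complete_edges V" using tree by (simp add: is_spanning_tree_def)
  then have finF: "finite F" using fin by (auto intro: finite_subset)
  have z: "z e \<ge> 0" if "e \<in> complete_edges V" for e
    unfolding z_def using x_nonneg[OF that] h by (intro sum_nonneg) simp
  have sum_ind: "(\<Sum>e\<in>A. indicator B e * f e) = sum f (A \<inter> B)" if "finite A"
    for A B :: "'a set set" and f :: "'a set \<Rightarrow> real"
    using that by (intro sum.mono_neutral_cong_right) (auto simp: indicator_def)
  have sum_y: "sum y A = a * card (F \<inter> A) + b * sum x A + g * sum z A" if "finite A" for A
    using sum_ind[OF that, of F "\<lambda>_. 1"]
    by (simp add: y_def sum.distrib Int_commute flip: sum_distrib_left)
  have cut_y: "sum y (cut V S) \<ge> 1" if S: "S \<subseteq> V" "odd (card (S \<inter> ?T))" for S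
  proof -
    \<comment> \<open>The existence of a join forces \<open>?T\<close> to have even size, which
      rules out \<open>S = V\<close>.\<close>
    have "T_join V ?T J" using J by (simp add: min_cost_T_join_def)
    moreover have "cut V V = {}" by (auto elim: cutE)
    ultimately have "even (card (V \<inter> ?T))" using T_join_odd_cut[OF fin, of ?T J V] by simp
    with S have "S \<noteq> V" "S \<noteq> {}" by auto
    then have "F \<inter> cut V S \<noteq> {}" using spanning_tree_crosses_cut[OF tree S(1)] by simp
    then have n1: "card (F \<inter> cut V S) \<ge> 1" using finF by (simp add: Suc_le_eq card_gt_0_iff)
    have z0: "sum z (cut V S) \<ge> 0" using z cut_subset by (intro sum_nonneg) blast
    with coeffs have gz: "g * sum z (cut V S) \<ge> 0" by simp
    show ?thesis
    proof (cases "card (S \<inter> {s, t}) = 1")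
      case False
      have "sum x (cut V S) \<ge> 2"
        using feasible False S(1) \<open>S \<noteq> V\<close> \<open>S \<noteq> {}\<close> by (auto simp: held_karp_feasible_def)
      then have "b * 2 \<le> b * sum x (cut V S)" using coeffs by (intro mult_left_mono) auto
      moreover have "a * 1 \<le> a * card (F \<inter> cut V S)"
        using coeffs n1 by (intro mult_left_mono) auto
      ultimately show ?thesis
        using coeffs gz fin by (simp add: sum_y)
    next
      case True
      then have "even (card (F \<inter> cut V S))" using odd_card_wrong_parity[OF F S(1)] S(2) by simp
      with n1 have "card (F \<inter> cut V S) \<ge> 2" by presburger
      then have a2: "a * 2 \<le> a * card (F \<inter> cut V S)"
        using coeffs by (intro mult_left_mono) auto
      \<comment> \<open>Passing to the complement leaves the cut unchanged and puts \<open>s\<close>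
        inside, as \<open>narrow_cuts\<close> expects.\<close>
      define U where "U = (if s \<in> S then S else V - S)"
      have cutU: "cut V U = cut V S" by (simp add: U_def cut_Compl)
      have "s \<in> S \<longleftrightarrow> t \<notin> S"
        using True st by (cases "s \<in> S"; cases "t \<in> S") auto
      then have U: "U \<subset> V" "s \<in> U" "t \<notin> U" using S s t by (auto simp: U_def)
      show ?thesis
      proof (cases "U \<in> narrow_cuts")
        case True
        have "sum x (cut V S) \<ge> 1" using held_karp_cut_st[OF feasible t, of U] U cutU by auto
        then have "b * 1 \<le> b * sum x (cut V S)" using coeffs by (intro mult_left_mono) auto
        \<comment> \<open>The tree crosses this cut evenly, so \<open>h U = 1\<close> and the
          summand of \<open>U\<close> in \<open>z\<close> alone supplies the full weight of its
          layer.\<close>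
        moreover have "1 - \<tau> / 2 \<le> sum z (cut V S)"
        proof -
          have sub: "?L U \<subseteq> cut V S" using cutU by (auto simp: layer_edges_def)
          have "1 - \<tau> / 2 \<le> sum x (?L U)" by (rule layer_edges_weight[OF True])
          also have "\<dots> = (\<Sum>e\<in>cut V S. h U * (indicator (?L U) e * x e))"
            using sum_ind[of "cut V S" "?L U" x] fin sub \<open>even (card (F \<inter> cut V S))\<close> cutU
            by (simp add: h_def Int_absorb1)
          also have "\<dots> \<le> sum z (cut V S)"
            unfolding z_def
          proof (intro sum_mono member_le_sum[OF True])
            fix e W assume "e \<in> cut V S"
            then have "x e \<ge> 0" using cut_subset x_nonneg by blast
            then show "h W * (indicator (?L W) e * x e) \<ge> 0" using h by simp
          qed (rule finite_narrow_cuts)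
          finally show ?thesis .
        qed
        then have "g * (1 - \<tau> / 2) \<le> g * sum z (cut V S)" using coeffs by (intro mult_left_mono) auto
        ultimately show ?thesis using a2 coeffs fin by (simp add: sum_y)
      next
        case False
        then have "sum x (cut V S) \<ge> 1 + \<tau>" using U cutU by (auto simp: narrow_cuts_def)
        then have "b * (1 + \<tau>) \<le> b * sum x (cut V S)" using coeffs by (intro mult_left_mono) auto
        then show ?thesis
          using a2 coeffs gz fin by (simp add: sum_y algebra_simps)
      qed
    qed
  qed
  have layer_sum: "(\<Sum>e\<in>complete_edges V. indicator (?L U) e * (c e * x e)) = (\<Sum>e\<in>?L U. c e * x e)" for U
    using sum_ind[of "complete_edges V" "?L U"] fin layer_edges_subset by (simp add: Int_absorb1)
  have "sum c J \<le> cost_vec V c y"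
  proof (rule min_cost_T_join_le_fractional[OF fin c _ cut_y J])
    show "y e \<ge> 0" if "e \<in> complete_edges V" for e
      using coeffs z[OF that] x_nonneg[OF that] by (simp add: y_def)
  qed
  also have "cost_vec V c y = a * (\<Sum>e\<in>complete_edges V. indicator F e * c e) + b * cost_vec V c x +
      g * (\<Sum>e\<in>complete_edges V. c e * z e)"
    by (simp add: cost_vec_def y_def algebra_simps sum.distrib sum_distrib_left)
  also have "(\<Sum>e\<in>complete_edges V. indicator F e * c e) = sum c F"
    using sum_ind[of "complete_edges V" F c] fin F by (simp add: Int_absorb1)
  also have "(\<Sum>e\<in>complete_edges V. c e * z e) =
      (\<Sum>U\<in>narrow_cuts. h U * (\<Sum>e\<in>complete_edges V. indicator (?L U) e * (c e * x e)))"
    unfolding z_def sum_distrib_left by (subst sum.swap) (simp add: mult_ac)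
  finally show ?thesis by (simp add: h_def layer_sum)
qed

end

section \<open>Averaging over the random tree\<close>

theorem theorem12:
  fixes V :: "'a set" and s t :: 'a and c x :: "'a set \<Rightarrow> real"
    and k :: nat and lam :: "nat \<Rightarrow> real" and p :: "nat pmf"
    and \<T> J :: "nat \<Rightarrow> 'a set set" and W H :: "nat \<Rightarrow> 'a list"
  assumes "finite V" and "s \<in> V" and "t \<in> V" and "s \<noteq> t"
    and "metric_cost V c"
    and "held_karp_optimal V c s t x"
    and "\<And>i. i \<in> {1..k} \<Longrightarrow> is_spanning_tree V (\<T> i)"
    and "\<And>i. i \<in> {1..k} \<Longrightarrow> lam i \<ge> 0"
    and "(\<Sum>i=1..k. lam i) = 1"
    and "\<And>e. e \<in> complete_edges V \<Longrightarrow> x e = (\<Sum>i=1..k. lam i * indicator (\<T> i) e)"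
    and "set_pmf p \<subseteq> {1..k}"
    and "\<And>i. i \<in> {1..k} \<Longrightarrow> pmf p i = lam i"
    and "\<And>i. i \<in> {1..k} \<Longrightarrow> min_cost_T_join V c (wrong_parity V s t (\<T> i)) (J i)"
    and "\<And>i. i \<in> {1..k} \<Longrightarrow> eulerian_path (mset_set (\<T> i) + mset_set (J i)) s t (W i)"
    and "\<And>i. i \<in> {1..k} \<Longrightarrow> shortcut_path V s t (W i) (H i)"
  shows "measure_pmf.expectation p (\<lambda>i. walk_cost c (H i)) \<le> 1.6577 * cost_vec V c x"
proof -
  note fin = assms(1) and metric = assms(5)
    and tree = assms(7) and lam = assms(8,9) and x = assms(10)
  \<comment> \<open>Given \<open>\<tau>\<close>, the coefficients making all three covering conditions tight are
    \<open>a = (1 - \<tau>) / (3 - \<tau>)\<close>, \<open>b = 1 / (3 - \<tau>)\<close> and \<open>g = b \<tau> / (1 - \<tau> / 2)\<close>; the resulting ratio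
    \<open>1 + a + b + g \<tau>\<close> is close to its minimum at \<open>\<tau> = 0.15\<close>.\<close>
  define \<tau> :: real where "\<tau> = 3 / 20"
  define h where "h i U = (of_bool (even (card (\<T> i \<inter> cut V U))) :: real)" for i U
  have \<tau>: "0 \<le> \<tau>" "\<tau> \<le> 1" by (simp_all add: \<tau>_def)
  have feasible: "held_karp_feasible V s t x" using assms(6) by (simp add: held_karp_optimal_def)
  interpret held_karp_point V s t x \<tau>
    by unfold_locales (fact assms(1-4) feasible \<tau>)+
  define w where "w U = (\<Sum>e\<in>layer_edges U. c e * x e)" for U
  have c: "c e \<ge> 0" if "e \<in> complete_edges V" for e using metric that by (simp add: metric_cost_def)
  have x0: "x e \<ge> 0" if "e \<in> complete_edges V" for e
    using feasible that by (simp add: held_karp_feasible_def)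
  have TE: "\<T> i \<subseteq> complete_edges V" if "i \<in> {1..k}" for i
    using tree[OF that] by (simp add: is_spanning_tree_def)
  then have finT: "finite (\<T> i)" if "i \<in> {1..k}" for i
    using that fin by (meson finite_complete_edges finite_subset)
  \<comment> \<open>Linearity of expectation. It is used with \<open>f = c\<close> on all edges for
    the expected tree cost, and with \<open>f = 1\<close> on a cut for the expected number of
    crossings.\<close>
  have average: "(\<Sum>i=1..k. lam i * sum f (\<T> i \<inter> A)) = (\<Sum>e\<in>A. f e * x e)"
    if A: "A \<subseteq> complete_edges V" for A and f :: "'a set \<Rightarrow> real"
  proof -
    have finA: "finite A" using finite_subset[OF A] fin by simp
    have tree_sum: "(\<Sum>e\<in>A. f e * indicator (\<T> i) e) = sum f (\<T> i \<inter> A)" for i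
      using finA by (intro sum.mono_neutral_cong_right) (auto simp: indicator_def)
    have "(\<Sum>e\<in>A. f e * x e) = (\<Sum>e\<in>A. \<Sum>i=1..k. lam i * (f e * indicator (\<T> i) e))"
    proof (intro sum.cong refl)
      fix e assume "e \<in> A"
      then have "x e = (\<Sum>i=1..k. lam i * indicator (\<T> i) e)" using A x by blast
      then show "f e * x e = (\<Sum>i=1..k. lam i * (f e * indicator (\<T> i) e))"
        by (simp only: sum_distrib_left mult.left_commute)
    qed
    also have "\<dots> = (\<Sum>i=1..k. lam i * (\<Sum>e\<in>A. f e * indicator (\<T> i) e))"
      by (subst sum.swap) (simp add: sum_distrib_left)
    finally show ?thesis by (simp add: tree_sum)
  qed
  have tree_cost: "(\<Sum>i=1..k. lam i * sum c (\<T> i)) = cost_vec V c x"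
    using average[OF order_refl, of c] TE by (simp add: cost_vec_def Int_absorb2)
  have cost_nonneg: "cost_vec V c x \<ge> 0"
    unfolding cost_vec_def using c x0 by (intro sum_nonneg) simp
  have w: "w U \<ge> 0" for U
    unfolding w_def using c x0 layer_edges_subset[of U]
    by (intro sum_nonneg) (auto intro!: mult_nonneg_nonneg)
  have w_sum: "(\<Sum>U\<in>narrow_cuts. w U) \<le> cost_vec V c x"
    using sum_layer_edges_le[of "\<lambda>e. c e * x e"] c x0
    by (simp add: w_def cost_vec_def)
  have even_prob: "(\<Sum>i=1..k. lam i * h i U) \<le> \<tau>" if U: "U \<in> narrow_cuts" for U
  proof -
    \<comment> \<open>A tree crosses the cut at least once, and an even number of crossings is then
      at least 2. So the excess over one crossing bounds the indicator of evenness, and its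
      expectation is \<open>sum x (cut V U) - 1\<close>.\<close>
    have "h i U \<le> real (card (\<T> i \<inter> cut V U)) - 1" if i: "i \<in> {1..k}" for i
    proof -
      have "\<T> i \<inter> cut V U \<noteq> {}"
        using U by (intro spanning_tree_crosses_cut[OF tree[OF i]]) (auto simp: narrow_cuts_def)
      then have "card (\<T> i \<inter> cut V U) \<ge> 1"
        using finT[OF i] by (simp add: Suc_le_eq card_gt_0_iff)
      moreover from this have "even (card (\<T> i \<inter> cut V U)) \<Longrightarrow> card (\<T> i \<inter> cut V U) \<ge> 2" by presburger
      ultimately show ?thesis by (auto simp: h_def of_bool_def)
    qed
    then have "(\<Sum>i=1..k. lam i * h i U) \<le> (\<Sum>i=1..k. lam i * (real (card (\<T> i \<inter> cut V U)) - 1))"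
      using lam by (intro sum_mono mult_left_mono) auto
    also have "\<dots> = sum x (cut V U) - 1"
      using average[OF cut_subset, of "\<lambda>_. 1" U] lam by (simp add: right_diff_distrib sum_subtractf)
    also have "\<dots> \<le> \<tau>" using U by (simp add: narrow_cuts_def)
    finally show ?thesis .
  qed
  \<comment> \<open>At \<open>\<tau> = 3/20\<close> the coefficients are \<open>a = 17/57\<close>,
    \<open>b = 20/57\<close> and \<open>g = 40/703\<close>; the tree itself adds 1 to
    \<open>a\<close>, giving \<open>74/57\<close>.\<close>
  have path_cost: "walk_cost c (H i) \<le> 74 / 57 * sum c (\<T> i) + 20 / 57 * cost_vec V c x +
      40 / 703 * (\<Sum>U\<in>narrow_cuts. h i U * w U)" if i: "i \<in> {1..k}" for i
  proof -
    have "J i \<subseteq> complete_edges V" using assms(13)[OF i] by (simp add: min_cost_T_join_def T_join_def)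
    then have "walk_cost c (H i) \<le> sum c (\<T> i) + sum c (J i)"
      by (rule walk_cost_shortcut[OF fin assms(2) metric TE[OF i] _ assms(14)[OF i] assms(15)[OF i]])
    moreover have "sum c (J i) \<le> 17 / 57 * sum c (\<T> i) + 20 / 57 * cost_vec V c x +
        40 / 703 * (\<Sum>U\<in>narrow_cuts. h i U * w U)"
      unfolding h_def w_def
      by (rule min_cost_T_join_le_tree[OF c tree[OF i] assms(13)[OF i]])
        (simp_all add: \<tau>_def)
    ultimately show ?thesis by simp
  qed
  have "measure_pmf.expectation p (\<lambda>i. walk_cost c (H i)) = (\<Sum>i=1..k. lam i * walk_cost c (H i))"
    using assms(11,12) by (subst integral_measure_pmf_real[of "{1..k}"]) (auto simp: mult.commute)
  also have "\<dots> \<le> (\<Sum>i=1..k. lam i * (74 / 57 * sum c (\<T> i) + 20 / 57 * cost_vec V c x +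
      40 / 703 * (\<Sum>U\<in>narrow_cuts. h i U * w U)))"
    using lam path_cost by (intro sum_mono mult_left_mono) auto
  also have "\<dots> = 94 / 57 * cost_vec V c x + 40 / 703 * (\<Sum>i=1..k. lam i * (\<Sum>U\<in>narrow_cuts. h i U * w U))"
  proof -
    have "(\<Sum>i=1..k. lam i * (74 / 57 * sum c (\<T> i) + 20 / 57 * cost_vec V c x +
        40 / 703 * (\<Sum>U\<in>narrow_cuts. h i U * w U))) =
      74 / 57 * (\<Sum>i=1..k. lam i * sum c (\<T> i)) + (\<Sum>i=1..k. lam i) * (20 / 57 * cost_vec V c x) +
        40 / 703 * (\<Sum>i=1..k. lam i * (\<Sum>U\<in>narrow_cuts. h i U * w U))"
      by (simp only: distrib_left sum.distrib sum_distrib_left sum_distrib_right mult_ac)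
    then show ?thesis using tree_cost lam by simp
  qed
  also have "(\<Sum>i=1..k. lam i * (\<Sum>U\<in>narrow_cuts. h i U * w U)) = (\<Sum>U\<in>narrow_cuts. (\<Sum>i=1..k. lam i * h i U) * w U)"
    unfolding sum_distrib_left sum_distrib_right by (subst sum.swap) (simp add: mult_ac)
  also have "\<dots> \<le> (\<Sum>U\<in>narrow_cuts. \<tau> * w U)"
    using even_prob w by (intro sum_mono mult_right_mono) auto
  also have "\<dots> \<le> \<tau> * cost_vec V c x"
    using w_sum \<tau> by (simp add: mult_left_mono flip: sum_distrib_left)
  \<comment> \<open>The exact ratio is \<open>94/57 + 6/703 = 184/111\<close>, about
    1.65766.\<close>
  also have "94 / 57 * cost_vec V c x + 40 / 703 * (\<tau> * cost_vec V c x) \<le> 1.6577 * cost_vec V c x"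
    using cost_nonneg by (simp add: \<tau>_def)
  finally show ?thesis by simp
qed

end
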